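(* Let $f:\mathbb{R}^n\to\mathbb{R}^n$ and $g^t:\mathcal{C}([-r,0],\mathbb{R}^n)\to\mathbb{R}^n$ ($t\ge 0$) satisfy the standing assumptions listed in the context (monotonicity, regularity, time-invariance on constant arguments, and the origin being an equilibrium). Suppose that the undelayed system $\frac{dy}{dt}(t)=f(y(t))+g^0(y(t)\mathbb{1})$ admits a solution $y:\mathbb{R}\to\mathbb{R}^n$ satisfying $\lim_{t\to-\infty}y_i(t)=\infty$ and $\lim_{t\to\infty}y_i(t)=0$ for all components $i$. Then the origin is globally asymptotically stable for the delayed system $\frac{dx}{dt}(t)=f(x(t))+g^t(x_t)$.
   Context: Notation: for $x,y\in\mathbb{R}^n$, $x\le y$ means $x_i\le y_i$ for all $i$. $\mathbb{R}^n_+=\{x\in\mathbb{R}^n: x\ge 0\}$. $r\ge 0$ is a fixed delay bound; $\mathcal{C}([-r,0],\mathbb{R}^n)$ is the Banach space of continuous functions $[-r,0]\to\mathbb{R}^n$ with the sup norm, and $\phi\le\psi$ means $\phi(\theta)\le\psi(\theta)$ for all $\theta\in[-r,0]$. For $v\in\mathbb{R}^n$, $v\mathbb{1}$ is the constant function on $[-r,0]$ with value $v$. For a function $x(t)$, $x_t\in\mathcal{C}([-r,0],\mathbb{R}^n)$ is $x_t(\theta)=x(t+\theta)$. $\mathcal{C}([-r,0],A)$ denotes those functions with values in $A$. Standing assumptions on $f$ and $g^t$: (1) if $x\le y$ and $x_i=y_i$ then $f_i(x)\le f_i(y)$, for all $x,y\in\mathbb{R}^n$; (2) if $\phi\le\psi$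 then $g^t(\phi)\le g^t(\psi)$, for all $\phi,\psi\in\mathcal{C}([-r,0],\mathbb{R}^n)$ and $t\ge 0$; (3) $t\mapsto g^t(\phi)$ is continuous for each fixed $\phi$; $f$ is locally Lipschitz, and $\phi\mapsto g^t(\phi)$ is locally Lipschitz for each fixed $t\ge0$; the delayed and undelayed systems have unique solutions through each initial datum, depending continuously on the initial data; (4) for each $v\in\mathbb{R}^n$, $g^t(v\mathbb{1})$ is independent of $t$ (so equals $g^0(v\mathbb{1})$; hence the undelayed system $\frac{dx}{dt}(t)=f(x(t))+g^t(x(t)\mathbb{1})$ is autonomous); (5) the origin is an equilibrium: $f(0)+g^0(0\,\mathbb{1})=0$. A solution of the delayed system with initial condition $x_{t_0}$ at time $t_0\ge 0$ satisfies the equation for $t\ge t_0$. Stability (restricted to the nonnegative cone): the origin is stable for the delayed system if for every $t_0\ge0$ and $\varepsilon>0$ there is $\delta>0$ such that any solution with $x_{t_0}\in\mathcal{C}([-r,0],\mathbb{R}^n_+)$ and $\|x_{t_0}\|<\delta$ satisfies $\|x_t\|<\varepsilon$ for all $t\ge t_0$. It is globally asymptotically stable if it is stable and $\lim_{t\to\infty}x(t)=0$ for every solution with initial condition $x_{t_0}\in\mathcal{C}([-r,0],\mathbb{R}^n_+)$, $t_0\ge 0$. *)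

theory Defs
  imports "HOL-Analysis.Analysis"
begin

text \<open>
  An element of \<open>C([-r,0], R^n)\<close> is represented by any function \<open>real \<Rightarrow> real ^ 'n\<close> that is
  continuous on \<open>{-r..0}\<close>; its values elsewhere carry no meaning. A functional on this space is
  therefore a function of type \<open>(real \<Rightarrow> real ^ 'n) \<Rightarrow> real ^ 'n\<close>. The monotonicity axiom
  \<open>g_mono\<close> below, applied in both directions, forces it to depend only on the values of its
  argument on \<open>{-r..0}\<close>.
\<close>

definition hist_space :: "real \<Rightarrow> (real \<Rightarrow> real ^ 'n) set" where
  "hist_space r = {\<phi>. continuous_on {-r..0} \<phi>}"

definition hist_nonneg :: "real \<Rightarrow> (real \<Rightarrow> real ^ 'n) set" where
  "hist_nonneg r = {\<phi> \<in> hist_space r. \<forall>\<theta>\<in>{-r..0}. 0 \<le> \<phi> \<theta>}"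

definition hist_le :: "real \<Rightarrow> (real \<Rightarrow> real ^ 'n) \<Rightarrow> (real \<Rightarrow> real ^ 'n) \<Rightarrow> bool" where
  "hist_le r \<phi> \<psi> \<longleftrightarrow> (\<forall>\<theta>\<in>{-r..0}. \<phi> \<theta> \<le> \<psi> \<theta>)"

definition hist_norm :: "real \<Rightarrow> (real \<Rightarrow> real ^ 'n) \<Rightarrow> real" where
  "hist_norm r \<phi> = (SUP \<theta>\<in>{-r..0}. norm (\<phi> \<theta>))"

definition hist_diff :: "(real \<Rightarrow> real ^ 'n) \<Rightarrow> (real \<Rightarrow> real ^ 'n) \<Rightarrow> real \<Rightarrow> real ^ 'n" where
  "hist_diff \<phi> \<psi> = (\<lambda>\<theta>. \<phi> \<theta> - \<psi> \<theta>)"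

definition hist_const :: "real ^ 'n \<Rightarrow> real \<Rightarrow> real ^ 'n" where
  "hist_const v = (\<lambda>_. v)"

definition hist_at :: "(real \<Rightarrow> real ^ 'n) \<Rightarrow> real \<Rightarrow> real \<Rightarrow> real ^ 'n" where
  "hist_at x t = (\<lambda>\<theta>. x (t + \<theta>))"

text \<open>At the initial time \<open>t0\<close> the derivative is the right-hand one.\<close>

definition delayed_solution ::
  "real \<Rightarrow> (real ^ 'n \<Rightarrow> real ^ 'n) \<Rightarrow> (real \<Rightarrow> (real \<Rightarrow> real ^ 'n) \<Rightarrow> real ^ 'n)
    \<Rightarrow> real \<Rightarrow> (real \<Rightarrow> real ^ 'n) \<Rightarrow> bool" where
  "delayed_solution r f g t0 x \<longleftrightarrow>
     continuous_on {t0 - r..} x \<and>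
     (\<forall>t\<ge>t0. (x has_vector_derivative f (x t) + g t (hist_at x t)) (at t within {t0..}))"

definition undelayed_solution ::
  "(real ^ 'n \<Rightarrow> real ^ 'n) \<Rightarrow> (real \<Rightarrow> (real \<Rightarrow> real ^ 'n) \<Rightarrow> real ^ 'n)
    \<Rightarrow> real set \<Rightarrow> (real \<Rightarrow> real ^ 'n) \<Rightarrow> bool" where
  "undelayed_solution f g S y \<longleftrightarrow>
     (\<forall>t\<in>S. (y has_vector_derivative f (y t) + g 0 (hist_const (y t))) (at t within S))"

locale monotone_delay_system =
  fixes r :: real
    and f :: "real ^ 'n \<Rightarrow> real ^ 'n"
    and g :: "real \<Rightarrow> (real \<Rightarrow> real ^ 'n) \<Rightarrow> real ^ 'n"
  assumes r_nonneg: "0 \<le> r"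
    and f_mono: "\<And>x y i. x \<le> y \<Longrightarrow> x $ i = y $ i \<Longrightarrow> f x $ i \<le> f y $ i"
    and g_mono: "\<And>t \<phi> \<psi>. 0 \<le> t \<Longrightarrow> \<phi> \<in> hist_space r \<Longrightarrow> \<psi> \<in> hist_space r \<Longrightarrow>
      hist_le r \<phi> \<psi> \<Longrightarrow> g t \<phi> \<le> g t \<psi>"
    and g_continuous: "\<And>\<phi>. \<phi> \<in> hist_space r \<Longrightarrow> continuous_on {0..} (\<lambda>t. g t \<phi>)"
    and f_lipschitz: "\<And>x. \<exists>u>0. \<exists>L. L-lipschitz_on (cball x u) f"
    and g_lipschitz: "\<And>t \<phi>. 0 \<le> t \<Longrightarrow> \<phi> \<in> hist_space r \<Longrightarrow>
      \<exists>u>0. \<exists>L\<ge>0. \<forall>\<phi>1\<in>hist_space r. \<forall>\<phi>2\<in>hist_space r.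
        hist_norm r (hist_diff \<phi>1 \<phi>) \<le> u \<longrightarrow> hist_norm r (hist_diff \<phi>2 \<phi>) \<le> u \<longrightarrow>
        norm (g t \<phi>1 - g t \<phi>2) \<le> L * hist_norm r (hist_diff \<phi>1 \<phi>2)"
    and delayed_unique_solution: "\<And>t0 \<phi>. 0 \<le> t0 \<Longrightarrow> \<phi> \<in> hist_space r \<Longrightarrow>
      \<exists>x. delayed_solution r f g t0 x \<and> (\<forall>\<theta>\<in>{-r..0}. hist_at x t0 \<theta> = \<phi> \<theta>) \<and>
        (\<forall>z. delayed_solution r f g t0 z \<and> (\<forall>\<theta>\<in>{-r..0}. hist_at z t0 \<theta> = \<phi> \<theta>)
          \<longrightarrow> (\<forall>t\<ge>t0. z t = x t))"
    and delayed_continuous_dependence: "\<And>t0 x T \<epsilon>. 0 \<le> t0 \<Longrightarrow> delayed_solution r f g t0 x \<Longrightarrow>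
      t0 \<le> T \<Longrightarrow> 0 < \<epsilon> \<Longrightarrow>
      \<exists>\<delta>>0. \<forall>z. delayed_solution r f g t0 z \<and>
          hist_norm r (hist_diff (hist_at z t0) (hist_at x t0)) < \<delta>
        \<longrightarrow> (\<forall>t\<in>{t0..T}. norm (z t - x t) < \<epsilon>)"
    and undelayed_unique_solution: "\<And>t0 v.
      \<exists>x. undelayed_solution f g {t0..} x \<and> x t0 = v \<and>
        (\<forall>z. undelayed_solution f g {t0..} z \<and> z t0 = v \<longrightarrow> (\<forall>t\<ge>t0. z t = x t))"
    and undelayed_continuous_dependence: "\<And>t0 x T \<epsilon>. undelayed_solution f g {t0..} x \<Longrightarrow>
      t0 \<le> T \<Longrightarrow> 0 < \<epsilon> \<Longrightarrow>
      \<exists>\<delta>>0. \<forall>z. undelayed_solution f g {t0..} z \<and> norm (z t0 - x t0) < \<delta>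
        \<longrightarrow> (\<forall>t\<in>{t0..T}. norm (z t - x t) < \<epsilon>)"
    and g_const: "\<And>t v. 0 \<le> t \<Longrightarrow> g t (hist_const v) = g 0 (hist_const v)"
    and origin_equilibrium: "f 0 + g 0 (hist_const 0) = 0"

text \<open>Stability and attractivity are relative to initial data in the nonnegative cone.\<close>

definition origin_stable ::
  "real \<Rightarrow> (real ^ 'n \<Rightarrow> real ^ 'n) \<Rightarrow> (real \<Rightarrow> (real \<Rightarrow> real ^ 'n) \<Rightarrow> real ^ 'n) \<Rightarrow> bool" where
  "origin_stable r f g \<longleftrightarrow>
     (\<forall>t0\<ge>0. \<forall>\<epsilon>>0. \<exists>\<delta>>0. \<forall>x. delayed_solution r f g t0 x \<and>
        hist_at x t0 \<in> hist_nonneg r \<and> hist_norm r (hist_at x t0) < \<delta>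
        \<longrightarrow> (\<forall>t\<ge>t0. hist_norm r (hist_at x t) < \<epsilon>))"

definition origin_globally_asymptotically_stable ::
  "real \<Rightarrow> (real ^ 'n \<Rightarrow> real ^ 'n) \<Rightarrow> (real \<Rightarrow> (real \<Rightarrow> real ^ 'n) \<Rightarrow> real ^ 'n) \<Rightarrow> bool" where
  "origin_globally_asymptotically_stable r f g \<longleftrightarrow>
     origin_stable r f g \<and>
     (\<forall>t0\<ge>0. \<forall>x. delayed_solution r f g t0 x \<and> hist_at x t0 \<in> hist_nonneg r
        \<longrightarrow> (x \<longlongrightarrow> 0) at_top)"

end

theory Submission
  imports Defs
begin

text \<open>
  Write \<open>h v = f v + g 0 (hist_const v)\<close> for the undelayed field. It is quasimonotone: \<open>h\<^sub>i\<close> is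
  nondecreasing in all coordinates other than the \<open>i\<close>-th. Call a constant vector \<open>v\<close> a supersolution if
  \<open>h v \<le> 0\<close> and a subsolution if \<open>0 \<le> h v\<close>. Constant histories do not feel the delay, and a
  history lying below \<open>w\<close> has \<open>g t\<close> bounded by its value at the constant history \<open>w\<close>, whatever
  \<open>t\<close> is. Comparison with constant vectors therefore only involves \<open>h\<close>: a delayed solution whose
  initial history lies below a supersolution stays below it, and likewise for subsolutions
  (\<open>delayed_solution_le_supersolution\<close>, \<open>delayed_solution_ge_subsolution\<close>). The equilibrium \<open>0\<close> is
  both, so nonnegative data give nonnegative solutions.

  The given solution \<open>y\<close> enters in two ways.

  It produces supersolutions. The vector of running minima, \<open>v\<^sub>i = min {y\<^sub>i s | s \<le> t}\<close>, is a
  supersolution (\<open>supersolution_below_y\<close>): if the minimum is attained at \<open>s\<close>, then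
  \<open>y\<^sub>i\<close> does not increase there, and quasimonotonicity gives
  \<open>h\<^sub>i v \<le> h\<^sub>i (y s) = y\<^sub>i' s \<le> 0\<close>. All entries of \<open>v\<close> are positive
  because those of \<open>y\<close> are nonnegative and never vanish; \<open>v\<close> is as small as desired for
  late \<open>t\<close> and as large as desired for early \<open>t\<close>. Small supersolutions give stability, large ones bound every delayed solution.

  It excludes nontrivial subsolutions. A subsolution lies below \<open>y t\<close> for very negative \<open>t\<close>, hence for
  all \<open>t\<close>, hence below the limit \<open>0\<close> (\<open>subsolution_nonpos\<close>).

  For attractivity let \<open>s\<close> be the componentwise upper limit of a delayed solution. It is a
  subsolution (\<open>upper_limit_is_subsolution\<close>): were \<open>h\<^sub>i s < 0\<close>, then \<open>x\<^sub>i\<close> would decrease at a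
  uniform rate whenever it comes close to \<open>s\<^sub>i\<close> at a late time, and could not have the upper limit
  \<open>s\<^sub>i\<close>. So \<open>s \<le> 0\<close>, and a nonnegative solution with nonpositive upper limit tends to \<open>0\<close>.
\<close>

section \<open>A barrier argument\<close>

lemma has_vector_derivative_component:
  fixes x :: "real \<Rightarrow> real ^ 'n"
  assumes "(x has_vector_derivative d) F"
  shows "((\<lambda>t. x t $ i) has_vector_derivative d $ i) F"
  using bounded_linear.has_vector_derivative[OF bounded_linear_vec_nth assms] .

text \<open>
  The curve \<open>x\<close> is compared with the strictly rising barriers \<open>v + \<epsilon> exp (M (t - t0))\<close>, \<open>M > K\<close>, and
  \<open>\<epsilon>\<close> tends to \<open>0\<close>. At a first contact, coordinate \<open>i\<close> touches a barrier of height \<open>e\<close> above \<open>v\<close>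
  while the whole past lies below that height; the bound \<open>K * e\<close> on its slope is less than the slope
  \<open>M * e\<close> of the barrier, which is impossible when approaching from below. Since the barriers rise, the
  past lies below the constant \<open>v + vec e\<close>, and this is the form in which a delayed right-hand side can
  exploit it. As \<open>\<epsilon>\<close> may be taken
  small, the barriers up to the time \<open>T\<close> stay within \<open>e0\<close> of \<open>v\<close>, where a local Lipschitz bound
  provides the hypothesis on the slopes.
\<close>

lemma stays_below_of_growth_at_contact:
  fixes x d :: "real \<Rightarrow> real ^ 'n"
  assumes cont: "continuous_on {t0..} x"
    and deriv: "\<And>t. t0 < t \<Longrightarrow> (x has_vector_derivative d t) (at t)"
    and init: "x t0 \<le> v"
    and e0: "0 < e0"
    and rate: "\<And>t i e. \<lbrakk>t0 < t; 0 < e; e \<le> e0; \<forall>s\<in>{t0..t}. x s \<le> v + vec e;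
       x t $ i = v $ i + e\<rbrakk> \<Longrightarrow> d t $ i \<le> K * e"
    and T: "t0 \<le> T"
  shows "x T \<le> v"
proof -
  define M where "M = \<bar>K\<bar> + 1"
  define b where "b \<epsilon> t = \<epsilon> * exp (M * (t - t0))" for \<epsilon> t :: real
  have M: "K < M" "0 < M" by (auto simp: M_def)
  have b_pos: "0 < b \<epsilon> t" if "0 < \<epsilon>" for \<epsilon> t
    using that by (simp add: b_def)
  have b_mono: "b \<epsilon> s \<le> b \<epsilon> t" if "0 < \<epsilon>" "s \<le> t" for \<epsilon> s t
    using that M by (simp add: b_def)
  have strict: "x t $ i < v $ i + b \<epsilon> t"
    if \<epsilon>: "0 < \<epsilon>" "b \<epsilon> T \<le> e0" and t: "t \<in> {t0..T}" for \<epsilon> t i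
  proof (rule ccontr)
    assume neg: "\<not> x t $ i < v $ i + b \<epsilon> t"
    define S where "S j = {s \<in> {t0..T}. v $ j + b \<epsilon> s \<le> x s $ j}" for j
    have "closed (S j)" for j
      unfolding S_def b_def
      by (intro continuous_on_closed_Collect_le continuous_intros continuous_on_subset[OF cont]
          closed_atLeastAtMost) auto
    define C where "C = (\<Union>j. S j)"
    have compact: "compact C"
      using \<open>\<And>j. closed (S j)\<close> unfolding C_def
      by (intro compact_UN) (auto simp: compact_eq_bounded_closed S_def
          intro: bounded_subset[OF bounded_closed_interval[of t0 T]])
    have "t \<in> S i" using neg t by (simp add: S_def)
    then have "C \<noteq> {}" by (auto simp: C_def)
    then obtain s where s: "s \<in> C" and first: "\<And>s'. s' \<in> C \<Longrightarrow> s \<le> s'"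
      using compact_attains_inf[OF compact] by blast
    then obtain j where j: "s \<in> S j" by (auto simp: C_def)
    have "x t0 $ j < v $ j + b \<epsilon> t0"
      using init b_pos[OF \<epsilon>(1), of t0] by (simp add: less_eq_vec_def order.strict_trans1[of "x t0 $ j" "v $ j"])
    with j have s0: "t0 < s" "s \<le> T" by (auto simp: S_def less_le)
    have below: "x s' $ k < v $ k + b \<epsilon> s'" if "s' \<in> {t0..<s}" for s' k
    proof (rule ccontr)
      assume "\<not> ?thesis"
      then have "s' \<in> S k" using that s0 by (simp add: S_def)
      then have "s \<le> s'" by (intro first) (auto simp: C_def)
      with that show False by simp
    qed
    \<comment> \<open>The strict inequality before the first contact passes to the limit.\<close>
    have at_s: "x s $ k \<le> v $ k + b \<epsilon> s" for k
    proof -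
      have "closed {s' \<in> {t0..s}. x s' $ k \<le> v $ k + b \<epsilon> s'}"
        unfolding b_def
        by (intro continuous_on_closed_Collect_le continuous_intros continuous_on_subset[OF cont]
            closed_atLeastAtMost) auto
      moreover have "{t0<..<s} \<subseteq> {s' \<in> {t0..s}. x s' $ k \<le> v $ k + b \<epsilon> s'}"
        using below by (auto intro: less_imp_le)
      ultimately have "closure {t0<..<s} \<subseteq> {s' \<in> {t0..s}. x s' $ k \<le> v $ k + b \<epsilon> s'}"
        by (rule closure_minimal[rotated])
      moreover have "s \<in> closure {t0<..<s}" using s0 by (simp add: closure_greaterThanLessThan)
      ultimately show ?thesis by blast
    qed
    have eq: "x s $ j = v $ j + b \<epsilon> s"
      using at_s[of j] j by (auto simp: S_def)
    have "x s' $ k \<le> v $ k + b \<epsilon> s" if "s' \<in> {t0..s}" for s' k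
      using below[of s' k] at_s[of k] b_mono[OF \<epsilon>(1), of s' s] that by (cases "s' = s") auto
    then have "\<forall>s'\<in>{t0..s}. x s' \<le> v + vec (b \<epsilon> s)" by (simp add: less_eq_vec_def)
    moreover have "b \<epsilon> s \<le> e0" using b_mono[OF \<epsilon>(1) s0(2)] \<epsilon>(2) by linarith
    ultimately have "d s $ j \<le> K * b \<epsilon> s"
      using rate[OF s0(1) b_pos[OF \<epsilon>(1)] _ _ eq] by blast
    also have "\<dots> < M * b \<epsilon> s" using M b_pos[OF \<epsilon>(1)] by simp
    finally have "d s $ j - M * b \<epsilon> s < 0" by simp
    moreover have "((\<lambda>t. x t $ j - (v $ j + b \<epsilon> t)) has_real_derivative
        d s $ j - M * b \<epsilon> s) (at s)"
      using has_vector_derivative_component[OF deriv[OF s0(1)], of j]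
      unfolding b_def has_real_derivative_iff_has_vector_derivative[symmetric]
      by (auto intro!: derivative_eq_intros)
    ultimately obtain h where h: "0 < h"
      "\<And>k. 0 < k \<Longrightarrow> k < h \<Longrightarrow> x s $ j - (v $ j + b \<epsilon> s) < x (s - k) $ j - (v $ j + b \<epsilon> (s - k))"
      using DERIV_neg_dec_left by blast
    define k where "k = min (h / 2) (s - t0)"
    have "0 < k" "k < h" "s - k \<in> {t0..<s}" using h(1) s0 by (auto simp: k_def)
    with h(2)[of k] below[of "s - k" j] eq show False by simp
  qed
  show ?thesis
    unfolding less_eq_vec_def
  proof (rule allI, rule field_le_epsilon)
    fix i and e :: real assume e: "0 < e"
    define \<epsilon> where "\<epsilon> = min e e0 / exp (M * (T - t0))"
    have "0 < \<epsilon>" using e e0 by (simp add: \<epsilon>_def)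
    moreover have "b \<epsilon> T = min e e0" by (simp add: \<epsilon>_def b_def)
    ultimately have "x T $ i < v $ i + min e e0" using strict[of \<epsilon> T i] T by simp
    then show "x T $ i \<le> v $ i + e" by linarith
  qed
qed

lemma stays_above_of_decay_at_contact:
  fixes x d :: "real \<Rightarrow> real ^ 'n"
  assumes cont: "continuous_on {t0..} x"
    and deriv: "\<And>t. t0 < t \<Longrightarrow> (x has_vector_derivative d t) (at t)"
    and init: "v \<le> x t0"
    and e0: "0 < e0"
    and rate: "\<And>t i e. \<lbrakk>t0 < t; 0 < e; e \<le> e0; \<forall>s\<in>{t0..t}. v - vec e \<le> x s;
       x t $ i = v $ i - e\<rbrakk> \<Longrightarrow> - K * e \<le> d t $ i"
    and T: "t0 \<le> T"
  shows "v \<le> x T"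
proof -
  have "- x T \<le> - v"
  proof (rule stays_below_of_growth_at_contact[where x = "\<lambda>t. - x t" and d = "\<lambda>t. - d t"
        and K = K, OF _ _ _ e0 _ T])
    show "continuous_on {t0..} (\<lambda>t. - x t)" by (intro continuous_intros cont)
    show "((\<lambda>t. - x t) has_vector_derivative - d t) (at t)" if "t0 < t" for t
      by (intro derivative_intros deriv that)
    show "- x t0 \<le> - v" using init by (auto simp: less_eq_vec_def)
    show "(- d t) $ i \<le> K * e" if "t0 < t" "0 < e" "e \<le> e0"
      "\<forall>s\<in>{t0..t}. - x s \<le> - v + vec e" "(- x t) $ i = (- v) $ i + e" for t i e
    proof -
      have "\<forall>s\<in>{t0..t}. v - vec e \<le> x s"
        using that(4) by (simp add: less_eq_vec_def algebra_simps)
      with rate[of t e i] that show ?thesis by auto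
    qed
  qed
  then show ?thesis by (auto simp: less_eq_vec_def)
qed

section \<open>Scalar differential inequalities\<close>

text \<open>
  Above the level \<open>c\<close> the function falls at speed at least \<open>\<eta>\<close>, so it reaches \<open>c\<close> in finite time; it
  cannot rise above \<open>c\<close> again, since it would be decreasing ever since it last was at or below \<open>c\<close>.
\<close>

lemma eventually_below_level_of_uniform_decrease:
  fixes u d :: "real \<Rightarrow> real"
  assumes deriv: "\<And>t. T \<le> t \<Longrightarrow> (u has_real_derivative d t) (at t)"
    and decr: "\<And>t. T \<le> t \<Longrightarrow> c \<le> u t \<Longrightarrow> d t \<le> - \<eta>"
    and \<eta>: "0 < \<eta>"
  shows "\<forall>\<^sub>F t in at_top. u t \<le> c"
proof -
  have "\<exists>t1\<ge>T. u t1 \<le> c"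
  proof (rule ccontr)
    assume "\<not> ?thesis"
    then have above: "c < u t" if "T \<le> t" for t using that by force
    \<comment> \<open>The time at which a decrease with speed exactly \<open>\<eta>\<close> would have reached the level \<open>c\<close>.\<close>
    define t where "t = T + (u T - c) / \<eta>"
    have t: "T \<le> t" using above[of T] \<eta> by (simp add: t_def)
    have "u t + \<eta> * t \<le> u T + \<eta> * T"
    proof (rule DERIV_nonpos_imp_nonincreasing[OF t])
      fix s assume "T \<le> s" "s \<le> t"
      then show "\<exists>y. ((\<lambda>s. u s + \<eta> * s) has_real_derivative y) (at s) \<and> y \<le> 0"
        using deriv[of s] decr[of s] above[of s]
        by (intro exI[of _ "d s + \<eta>"]) (auto intro!: derivative_eq_intros)
    qed
    moreover have "\<eta> * (t - T) = u T - c" using \<eta> by (simp add: t_def)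
    ultimately have "u t \<le> c" by (simp add: algebra_simps)
    with above[OF t] show False by simp
  qed
  then obtain t1 where t1: "T \<le> t1" "u t1 \<le> c" by blast
  have "u t \<le> c" if "t1 \<le> t" for t
  proof (rule ccontr)
    assume neg: "\<not> u t \<le> c"
    have cont: "continuous_on {t1..t} u"
      using t1 deriv by (intro DERIV_continuous_on[of _ _ d]) (auto intro: has_field_derivative_at_within)
    have "closed {s \<in> {t1..t}. u s \<le> c}"
      by (intro continuous_on_closed_Collect_le continuous_intros cont closed_atLeastAtMost)
    then have "compact {s \<in> {t1..t}. u s \<le> c}"
      by (auto simp: compact_eq_bounded_closed intro: bounded_subset[OF bounded_closed_interval[of t1 t]])
    moreover have "t1 \<in> {s \<in> {t1..t}. u s \<le> c}" using t1 that by auto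
    ultimately obtain s where s: "s \<in> {t1..t}" "u s \<le> c"
      and last: "\<And>s'. s' \<in> {t1..t} \<Longrightarrow> u s' \<le> c \<Longrightarrow> s' \<le> s"
      using compact_attains_sup[of "{s \<in> {t1..t}. u s \<le> c}"] by blast
    have "u t \<le> u s"
    proof (rule DERIV_nonpos_imp_decreasing_open[of s t u])
      show "s \<le> t" using s by auto
      show "\<exists>y. (u has_real_derivative y) (at s') \<and> y \<le> 0" if "s < s'" "s' < t" for s'
        using deriv[of s'] decr[of s'] last[of s'] that s t1 \<eta> by (intro exI[of _ "d s'"]) force
      show "continuous_on {s..t} u" using s by (intro continuous_on_subset[OF cont]) auto
    qed
    with s neg show False by simp
  qed
  then show ?thesis by (auto simp: eventually_at_top_linorder)
qed

text \<open>
  Near \<open>0\<close> the function decays at most exponentially: \<open>exp (L * t) * u t\<close> is nondecreasing as long as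
  \<open>u\<close> stays below \<open>\<delta>\<close>, so \<open>u\<close> needs infinite time to vanish. The monotone quantity is used from the
  last time at which \<open>u\<close> was at least \<open>min \<delta> (u t0)\<close>.
\<close>

lemma positive_of_linear_decay:
  fixes u d :: "real \<Rightarrow> real"
  assumes deriv: "\<And>t. t0 \<le> t \<Longrightarrow> (u has_real_derivative d t) (at t)"
    and decay: "\<And>t. t0 \<le> t \<Longrightarrow> 0 \<le> u t \<Longrightarrow> u t \<le> \<delta> \<Longrightarrow> - L * u t \<le> d t"
    and nonneg: "\<And>t. t0 \<le> t \<Longrightarrow> 0 \<le> u t"
    and \<delta>: "0 < \<delta>" and init: "0 < u t0" and t: "t0 \<le> t"
  shows "0 < u t"
proof (rule ccontr)
  assume "\<not> 0 < u t"
  with nonneg[OF t] have zero: "u t = 0" by simp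
  define c where "c = min \<delta> (u t0)"
  have c: "0 < c" "c \<le> \<delta>" "c \<le> u t0" using \<delta> init by (auto simp: c_def)
  have cont: "continuous_on {t0..t} u"
    using deriv by (intro DERIV_continuous_on[of _ _ d]) (auto intro: has_field_derivative_at_within)
  have "closed {s \<in> {t0..t}. c \<le> u s}"
    by (intro continuous_on_closed_Collect_le continuous_intros cont closed_atLeastAtMost)
  then have "compact {s \<in> {t0..t}. c \<le> u s}"
    by (auto simp: compact_eq_bounded_closed intro: bounded_subset[OF bounded_closed_interval[of t0 t]])
  moreover have "t0 \<in> {s \<in> {t0..t}. c \<le> u s}" using t c by auto
  ultimately obtain s where s: "s \<in> {t0..t}" "c \<le> u s"
    and last: "\<And>s'. s' \<in> {t0..t} \<Longrightarrow> c \<le> u s' \<Longrightarrow> s' \<le> s"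
    using compact_attains_sup[of "{s \<in> {t0..t}. c \<le> u s}"] by blast
  have "exp (L * s) * u s \<le> exp (L * t) * u t"
  proof (rule DERIV_nonneg_imp_increasing_open[of s t "\<lambda>s. exp (L * s) * u s"])
    show "s \<le> t" using s by auto
    show "continuous_on {s..t} (\<lambda>s. exp (L * s) * u s)"
      using s by (intro continuous_intros continuous_on_subset[OF cont]) auto
    show "\<exists>y. ((\<lambda>s. exp (L * s) * u s) has_real_derivative y) (at s') \<and> 0 \<le> y"
      if "s < s'" "s' < t" for s'
    proof (intro exI conjI)
      have s': "t0 \<le> s'" using that s by auto
      have "u s' \<le> \<delta>" using last[of s'] that s c(2) by force
      then have "0 \<le> L * u s' + d s'" using decay[OF s' nonneg[OF s']] by simp
      then show "0 \<le> exp (L * s') * (L * u s' + d s')" by simp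
      show "((\<lambda>s. exp (L * s) * u s) has_real_derivative exp (L * s') * (L * u s' + d s')) (at s')"
        using deriv[OF s'] by (auto intro!: derivative_eq_intros simp: algebra_simps)
    qed
  qed
  moreover have "0 < exp (L * s) * u s" using s c by simp
  ultimately show False using zero by simp
qed

section \<open>The field on constant histories\<close>

definition undelayed_field ::
  "(real ^ 'n \<Rightarrow> real ^ 'n) \<Rightarrow> (real \<Rightarrow> (real \<Rightarrow> real ^ 'n) \<Rightarrow> real ^ 'n) \<Rightarrow> real ^ 'n \<Rightarrow> real ^ 'n"
  where "undelayed_field f g v = f v + g 0 (hist_const v)"

text \<open>
  Barriers and quasimonotonicity speak of single coordinates, so the Lipschitz bounds are needed with
  respect to the maximum norm; the factor \<open>CARD('n)\<close> pays for the comparison with the Euclidean norm.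
\<close>

lemma componentwise_bound_of_local_lipschitz:
  fixes F :: "real ^ 'n \<Rightarrow> real ^ 'n"
  assumes "0 < u" "0 \<le> L" "\<And>w. norm (w - v) \<le> u \<Longrightarrow> norm (F w - F v) \<le> L * norm (w - v)"
  shows "\<exists>e0>0. \<exists>K\<ge>0. \<forall>w e i. e \<le> e0 \<longrightarrow> (\<forall>j. \<bar>w $ j - v $ j\<bar> \<le> e) \<longrightarrow>
    \<bar>F w $ i - F v $ i\<bar> \<le> K * e"
proof (intro exI conjI allI impI)
  let ?n = "real CARD('n)"
  show "0 < u / ?n" using assms by simp
  show "0 \<le> L * ?n" using assms by simp
  fix w e i assume e: "e \<le> u / ?n" and w: "\<forall>j. \<bar>w $ j - v $ j\<bar> \<le> e"
  have "norm (w - v) \<le> (\<Sum>j\<in>UNIV. \<bar>(w - v) $ j\<bar>)" by (rule norm_le_l1_cart)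
  also have "\<dots> \<le> ?n * e" using sum_bounded_above[of UNIV "\<lambda>j. \<bar>(w - v) $ j\<bar>" e] w by simp
  finally have n: "norm (w - v) \<le> ?n * e" .
  also have "?n * e \<le> u" using e by (simp add: field_simps)
  finally have "norm (F w - F v) \<le> L * norm (w - v)" by (rule assms(3))
  also have "\<dots> \<le> L * (?n * e)" using n assms(2) by (rule mult_left_mono)
  finally show "\<bar>F w $ i - F v $ i\<bar> \<le> L * ?n * e"
    using component_le_norm_cart[of "F w - F v" i] by simp
qed

lemma undelayed_solution_derivative:
  assumes "undelayed_solution f g UNIV y"
  shows "(y has_vector_derivative undelayed_field f g (y t)) (at t)"
  using assms by (simp add: undelayed_solution_def undelayed_field_def)

lemma delayed_solution_derivative:
  assumes "delayed_solution r f g t0 x" "t0 < t"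
  shows "(x has_vector_derivative f (x t) + g t (hist_at x t)) (at t)"
proof -
  have "(x has_vector_derivative f (x t) + g t (hist_at x t)) (at t within {t0..})"
    using assms by (auto simp: delayed_solution_def)
  moreover have "at t within {t0..} = at t"
    using assms(2) by (intro at_within_interior) simp
  ultimately show ?thesis by simp
qed

lemma hist_at_in_hist_space:
  assumes "delayed_solution r f g t0 x" "t0 \<le> t"
  shows "hist_at x t \<in> hist_space r"
proof -
  have "continuous_on {t0 - r..} x" using assms by (simp add: delayed_solution_def)
  then show ?thesis
    unfolding hist_space_def hist_at_def using assms(2)
    by (auto intro!: continuous_on_compose2[of "{t0 - r..}" x] continuous_intros)
qed

context monotone_delay_system
begin

lemma hist_const_in_hist_space [simp]: "hist_const v \<in> hist_space r"
  by (simp add: hist_space_def hist_const_def)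

lemma g_hist_const_mono: "v \<le> w \<Longrightarrow> g 0 (hist_const v) \<le> g 0 (hist_const w)"
  by (rule g_mono[OF order_refl hist_const_in_hist_space hist_const_in_hist_space])
    (simp add: hist_le_def hist_const_def)

lemma undelayed_field_quasimonotone:
  "x \<le> w \<Longrightarrow> x $ i = w $ i \<Longrightarrow> undelayed_field f g x $ i \<le> undelayed_field f g w $ i"
  using f_mono[of x w i] g_hist_const_mono[of x w]
  by (simp add: undelayed_field_def less_eq_vec_def add_mono)

lemma f_componentwise_bound:
  "\<exists>e0>0. \<exists>K\<ge>0. \<forall>w e i. e \<le> e0 \<longrightarrow> (\<forall>j. \<bar>w $ j - v $ j\<bar> \<le> e) \<longrightarrow> \<bar>f w $ i - f v $ i\<bar> \<le> K * e"
proof -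
  obtain u L where u: "0 < u" and L: "L-lipschitz_on (cball v u) f"
    using f_lipschitz by blast
  have "norm (f w - f v) \<le> L * norm (w - v)" if "norm (w - v) \<le> u" for w
    using lipschitz_onD[OF L, of w v] that u by (simp add: dist_norm norm_minus_commute)
  then show ?thesis
    by (rule componentwise_bound_of_local_lipschitz[OF u lipschitz_on_nonneg[OF L]])
qed

lemma g_hist_const_componentwise_bound:
  "\<exists>e0>0. \<exists>K\<ge>0. \<forall>w e i. e \<le> e0 \<longrightarrow> (\<forall>j. \<bar>w $ j - v $ j\<bar> \<le> e) \<longrightarrow>
    \<bar>g 0 (hist_const w) $ i - g 0 (hist_const v) $ i\<bar> \<le> K * e"
proof -
  have norm_const: "hist_norm r (hist_diff (hist_const a) (hist_const b)) = norm (a - b)"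
    for a b :: "real ^ 'n"
    using r_nonneg by (simp add: hist_norm_def hist_diff_def hist_const_def)
  obtain u L where u: "0 < u" and L: "0 \<le> L"
    and lip: "\<And>\<phi>1 \<phi>2. \<lbrakk>\<phi>1 \<in> hist_space r; \<phi>2 \<in> hist_space r;
        hist_norm r (hist_diff \<phi>1 (hist_const v)) \<le> u;
        hist_norm r (hist_diff \<phi>2 (hist_const v)) \<le> u\<rbrakk> \<Longrightarrow>
        norm (g 0 \<phi>1 - g 0 \<phi>2) \<le> L * hist_norm r (hist_diff \<phi>1 \<phi>2)"
    using g_lipschitz[of 0 "hist_const v"] by auto
  show ?thesis
    by (rule componentwise_bound_of_local_lipschitz[where F = "\<lambda>v. g 0 (hist_const v)", OF u L])
       (use lip[of "hist_const _" "hist_const v"] u in \<open>simp add: norm_const\<close>)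
qed

lemma undelayed_field_componentwise_bound:
  "\<exists>e0>0. \<exists>K\<ge>0. \<forall>w e i. e \<le> e0 \<longrightarrow> (\<forall>j. \<bar>w $ j - v $ j\<bar> \<le> e) \<longrightarrow>
    \<bar>undelayed_field f g w $ i - undelayed_field f g v $ i\<bar> \<le> K * e"
proof -
  obtain e1 K1 where 1: "0 < e1" "0 \<le> K1" "\<And>w e i. e \<le> e1 \<Longrightarrow> \<forall>j. \<bar>w $ j - v $ j\<bar> \<le> e \<Longrightarrow>
      \<bar>f w $ i - f v $ i\<bar> \<le> K1 * e"
    using f_componentwise_bound[of v] by blast
  obtain e2 K2 where 2: "0 < e2" "0 \<le> K2" "\<And>w e i. e \<le> e2 \<Longrightarrow> \<forall>j. \<bar>w $ j - v $ j\<bar> \<le> e \<Longrightarrow>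
      \<bar>g 0 (hist_const w) $ i - g 0 (hist_const v) $ i\<bar> \<le> K2 * e"
    using g_hist_const_componentwise_bound[of v] by blast
  show ?thesis
  proof (rule exI[of _ "min e1 e2"], intro conjI, use 1 2 in simp,
      rule exI[of _ "K1 + K2"], intro conjI allI impI)
    show "0 \<le> K1 + K2" using 1 2 by simp
    fix w e i assume "e \<le> min e1 e2" "\<forall>j. \<bar>w $ j - v $ j\<bar> \<le> e"
    with 1(3)[of e w i] 2(3)[of e w i]
    show "\<bar>undelayed_field f g w $ i - undelayed_field f g v $ i\<bar> \<le> (K1 + K2) * e"
      by (simp add: undelayed_field_def distrib_right)
  qed
qed

text \<open>
  The two parts of the right-hand side tolerate different bounds. In \<open>g\<close> the whole recent history may be
  replaced by any constant \<open>w\<close> above it; in \<open>f\<close> the bound \<open>w'\<close> must keep the \<open>i\<close>-th coordinate of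
  \<open>x t\<close>. For a barrier argument \<open>w = w'\<close>, but upper limits require two different vectors.
\<close>

lemma delayed_rhs_upper:
  assumes sol: "delayed_solution r f g t0 x" and t: "0 \<le> t0" "t0 \<le> t"
    and hist: "\<And>s. s \<in> {t - r..t} \<Longrightarrow> x s \<le> w"
    and w': "x t \<le> w'" "x t $ i = w' $ i"
  shows "(f (x t) + g t (hist_at x t)) $ i \<le> f w' $ i + g 0 (hist_const w) $ i"
proof -
  have "g t (hist_at x t) \<le> g t (hist_const w)"
    using t hist hist_at_in_hist_space[OF sol t(2)]
    by (intro g_mono hist_const_in_hist_space) (auto simp: hist_le_def hist_at_def hist_const_def)
  also have "\<dots> = g 0 (hist_const w)" using t by (intro g_const) simp
  finally show ?thesis using f_mono[OF w'] by (simp add: less_eq_vec_def add_mono)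
qed

lemma delayed_rhs_lower:
  assumes sol: "delayed_solution r f g t0 x" and t: "0 \<le> t0" "t0 \<le> t"
    and hist: "\<And>s. s \<in> {t - r..t} \<Longrightarrow> w \<le> x s"
    and w': "w' \<le> x t" "x t $ i = w' $ i"
  shows "f w' $ i + g 0 (hist_const w) $ i \<le> (f (x t) + g t (hist_at x t)) $ i"
proof -
  have "g 0 (hist_const w) = g t (hist_const w)" using t by (intro g_const[symmetric]) simp
  also have "\<dots> \<le> g t (hist_at x t)"
    using t hist hist_at_in_hist_space[OF sol t(2)]
    by (intro g_mono hist_const_in_hist_space) (auto simp: hist_le_def hist_at_def hist_const_def)
  finally show ?thesis using f_mono[OF w'(1) w'(2)[symmetric]] by (simp add: less_eq_vec_def add_mono)
qed

section \<open>Constant barriers\<close>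

text \<open>
  At a contact with height \<open>e\<close> above \<open>v\<close>, the right-hand side is at most that of the undelayed field
  at \<open>v + vec e\<close>, which exceeds the one at \<open>v\<close>, a nonpositive vector, by at most \<open>K * e\<close>. The constant
  \<open>K\<close> comes from the autonomous field, so one value serves all times.
\<close>

lemma delayed_solution_le_supersolution:
  assumes sol: "delayed_solution r f g t0 x" and t0: "0 \<le> t0"
    and hist: "\<And>s. s \<in> {t0 - r..t0} \<Longrightarrow> x s \<le> v"
    and super: "undelayed_field f g v \<le> 0" and T: "t0 \<le> T"
  shows "x T \<le> v"
proof -
  obtain e0 K where e0: "0 < e0"
    and K: "\<And>w e i. e \<le> e0 \<Longrightarrow> \<forall>j. \<bar>w $ j - v $ j\<bar> \<le> e \<Longrightarrow>
      \<bar>undelayed_field f g w $ i - undelayed_field f g v $ i\<bar> \<le> K * e"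
    using undelayed_field_componentwise_bound[of v] by blast
  show ?thesis
  proof (rule stays_below_of_growth_at_contact[where K = K, OF _ _ _ e0 _ T])
    show "continuous_on {t0..} x"
      using sol r_nonneg by (auto simp: delayed_solution_def intro: continuous_on_subset)
    show "x t0 \<le> v" using hist r_nonneg by simp
    show "(x has_vector_derivative f (x t) + g t (hist_at x t)) (at t)" if "t0 < t" for t
      by (rule delayed_solution_derivative[OF sol that])
    fix t i e
    assume t: "t0 < t" and e: "0 < e" "e \<le> e0"
      and le: "\<forall>s\<in>{t0..t}. x s \<le> v + vec e" and eq: "x t $ i = v $ i + e"
    have all: "x s \<le> v + vec e" if "s \<in> {t - r..t}" for s
    proof (cases "t0 \<le> s")
      case True then show ?thesis using le that by simp
    next
      case False
      then have "x s \<le> v" using hist t that by simp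
      also have "v \<le> v + vec e" using e by (simp add: less_eq_vec_def)
      finally show ?thesis .
    qed
    have "(f (x t) + g t (hist_at x t)) $ i \<le> undelayed_field f g (v + vec e) $ i"
      using delayed_rhs_upper[OF sol t0 less_imp_le[OF t] all, of "v + vec e" i] all[of t] eq
        r_nonneg by (simp add: undelayed_field_def)
    also have "\<dots> \<le> undelayed_field f g v $ i + K * e"
      using K[of e "v + vec e" i] e by (simp add: abs_le_iff)
    also have "\<dots> \<le> K * e" using super by (simp add: less_eq_vec_def)
    finally show "(f (x t) + g t (hist_at x t)) $ i \<le> K * e" .
  qed
qed

lemma delayed_solution_ge_subsolution:
  assumes sol: "delayed_solution r f g t0 x" and t0: "0 \<le> t0"
    and hist: "\<And>s. s \<in> {t0 - r..t0} \<Longrightarrow> v \<le> x s"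
    and sub: "0 \<le> undelayed_field f g v" and T: "t0 \<le> T"
  shows "v \<le> x T"
proof -
  obtain e0 K where e0: "0 < e0"
    and K: "\<And>w e i. e \<le> e0 \<Longrightarrow> \<forall>j. \<bar>w $ j - v $ j\<bar> \<le> e \<Longrightarrow>
      \<bar>undelayed_field f g w $ i - undelayed_field f g v $ i\<bar> \<le> K * e"
    using undelayed_field_componentwise_bound[of v] by blast
  show ?thesis
  proof (rule stays_above_of_decay_at_contact[where K = K, OF _ _ _ e0 _ T])
    show "continuous_on {t0..} x"
      using sol r_nonneg by (auto simp: delayed_solution_def intro: continuous_on_subset)
    show "v \<le> x t0" using hist r_nonneg by simp
    show "(x has_vector_derivative f (x t) + g t (hist_at x t)) (at t)" if "t0 < t" for t
      by (rule delayed_solution_derivative[OF sol that])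
    fix t i e
    assume t: "t0 < t" and e: "0 < e" "e \<le> e0"
      and ge: "\<forall>s\<in>{t0..t}. v - vec e \<le> x s" and eq: "x t $ i = v $ i - e"
    have all: "v - vec e \<le> x s" if "s \<in> {t - r..t}" for s
    proof (cases "t0 \<le> s")
      case True then show ?thesis using ge that by simp
    next
      case False
      have "v - vec e \<le> v" using e by (simp add: less_eq_vec_def)
      also have "v \<le> x s" using False hist t that by simp
      finally show ?thesis .
    qed
    have "- K * e \<le> undelayed_field f g v $ i - K * e"
      using sub by (simp add: less_eq_vec_def)
    also have "\<dots> \<le> undelayed_field f g (v - vec e) $ i"
      using K[of e "v - vec e" i] e by (simp add: abs_le_iff)
    also have "\<dots> \<le> (f (x t) + g t (hist_at x t)) $ i"
      using delayed_rhs_lower[OF sol t0 less_imp_le[OF t] all, of "v - vec e" i] all[of t] eq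
        r_nonneg by (simp add: undelayed_field_def)
    finally show "- K * e \<le> (f (x t) + g t (hist_at x t)) $ i" .
  qed
qed

lemma undelayed_solution_ge_subsolution:
  assumes sol: "undelayed_solution f g UNIV y"
    and init: "v \<le> y t0"
    and sub: "0 \<le> undelayed_field f g v" and T: "t0 \<le> T"
  shows "v \<le> y T"
proof -
  obtain e0 K where e0: "0 < e0"
    and K: "\<And>w e i. e \<le> e0 \<Longrightarrow> \<forall>j. \<bar>w $ j - v $ j\<bar> \<le> e \<Longrightarrow>
      \<bar>undelayed_field f g w $ i - undelayed_field f g v $ i\<bar> \<le> K * e"
    using undelayed_field_componentwise_bound[of v] by blast
  note deriv = undelayed_solution_derivative[OF sol]
  show ?thesis
  proof (rule stays_above_of_decay_at_contact[where K = K, OF _ deriv init e0 _ T])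
    show "continuous_on {t0..} y"
      by (intro continuous_at_imp_continuous_on ballI has_vector_derivative_continuous[OF deriv])
    fix t i e
    assume t: "t0 < t" and e: "0 < e" "e \<le> e0"
      and ge: "\<forall>s\<in>{t0..t}. v - vec e \<le> y s" and eq: "y t $ i = v $ i - e"
    have "- K * e \<le> undelayed_field f g v $ i - K * e"
      using sub by (simp add: less_eq_vec_def)
    also have "\<dots> \<le> undelayed_field f g (v - vec e) $ i"
      using K[of e "v - vec e" i] e by (simp add: abs_le_iff)
    also have "\<dots> \<le> undelayed_field f g (y t) $ i"
      using ge eq t by (intro undelayed_field_quasimonotone) auto
    finally show "- K * e \<le> undelayed_field f g (y t) $ i" .
  qed
qed

lemma undelayed_field_0: "undelayed_field f g 0 = 0"
  using origin_equilibrium by (simp add: undelayed_field_def)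

lemma delayed_solution_nonneg:
  assumes sol: "delayed_solution r f g t0 x" and t0: "0 \<le> t0"
    and hist: "\<And>s. s \<in> {t0 - r..t0} \<Longrightarrow> 0 \<le> x s" and t: "t0 - r \<le> t"
  shows "0 \<le> x t"
proof (cases "t0 \<le> t")
  case True
  then show ?thesis using delayed_solution_ge_subsolution[OF sol t0 hist] undelayed_field_0 by simp
next
  case False
  then show ?thesis using hist t by simp
qed

section \<open>Upper limits of delayed solutions\<close>

text \<open>
  The hypotheses say that \<open>s $ i\<close> is the upper limit of \<open>x t $ i\<close> as \<open>t\<close> tends to infinity. After a
  late time all values in the delay window lie below \<open>s + vec e\<close>. If moreover \<open>x t $ i\<close> is within \<open>e\<close>
  of \<open>s $ i\<close>, its derivative is at most \<open>undelayed_field f g s $ i\<close> plus a multiple of \<open>e\<close>. A negative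
  value of the field would thus make \<open>x t $ i\<close> settle below \<open>s $ i - e\<close>.
\<close>

lemma upper_limit_is_subsolution:
  assumes sol: "delayed_solution r f g t0 x" and t0: "0 \<le> t0"
    and upper: "\<And>i e. 0 < e \<Longrightarrow> \<forall>\<^sub>F t in at_top. x t $ i \<le> s $ i + e"
    and least: "\<And>i e. 0 < e \<Longrightarrow> \<not> (\<forall>\<^sub>F t in at_top. x t $ i \<le> s $ i - e)"
  shows "0 \<le> undelayed_field f g s"
proof (rule ccontr)
  assume "\<not> ?thesis"
  then obtain i where neg: "undelayed_field f g s $ i < 0"
    by (auto simp: less_eq_vec_def not_le)
  define \<eta> where "\<eta> = - undelayed_field f g s $ i / 2"
  have \<eta>: "0 < \<eta>" using neg by (simp add: \<eta>_def)
  obtain e1 K1 where 1: "0 < e1" "0 \<le> K1" "\<And>w e i. e \<le> e1 \<Longrightarrow> \<forall>j. \<bar>w $ j - s $ j\<bar> \<le> e \<Longrightarrow>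
      \<bar>f w $ i - f s $ i\<bar> \<le> K1 * e"
    using f_componentwise_bound[of s] by blast
  obtain e2 K2 where 2: "0 < e2" "0 \<le> K2" "\<And>w e i. e \<le> e2 \<Longrightarrow> \<forall>j. \<bar>w $ j - s $ j\<bar> \<le> e \<Longrightarrow>
      \<bar>g 0 (hist_const w) $ i - g 0 (hist_const s) $ i\<bar> \<le> K2 * e"
    using g_hist_const_componentwise_bound[of s] by blast
  \<comment> \<open>So small that the two Lipschitz errors together cost at most half of the negative value.\<close>
  define e where "e = min (min e1 e2) (\<eta> / (K1 + K2 + 1))"
  have e: "0 < e" "e \<le> e1" "e \<le> e2" using 1 2 \<eta> by (auto simp: e_def)
  have "(K1 + K2) * e \<le> (K1 + K2 + 1) * e" using e by simp
  also have "\<dots> \<le> (K1 + K2 + 1) * (\<eta> / (K1 + K2 + 1))"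
    using 1 2 by (intro mult_left_mono) (auto simp: e_def)
  also have "\<dots> = \<eta>" using 1 2 by simp
  finally have small: "K1 * e + K2 * e \<le> \<eta>" by (simp add: distrib_right)
  have "\<forall>\<^sub>F t in at_top. \<forall>j. x t $ j \<le> s $ j + e"
    using upper[OF e(1)] by (rule eventually_all_finite)
  then obtain T0 where T0: "\<And>t. T0 \<le> t \<Longrightarrow> x t \<le> s + vec e"
    by (auto simp: eventually_at_top_linorder less_eq_vec_def)
  \<comment> \<open>Late enough for the two-sided derivative and for the whole delay window to lie after \<open>T0\<close>.\<close>
  define T where "T = max (t0 + 1) (T0 + r)"
  have "\<forall>\<^sub>F t in at_top. x t $ i \<le> s $ i - e"
  proof (rule eventually_below_level_of_uniform_decrease[where T = T and \<eta> = \<eta>, OF _ _ \<eta>])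
    show "((\<lambda>t. x t $ i) has_real_derivative (f (x t) + g t (hist_at x t)) $ i) (at t)"
      if "T \<le> t" for t
      using has_vector_derivative_component[OF delayed_solution_derivative[OF sol, of t], of i] that
      by (simp add: T_def has_real_derivative_iff_has_vector_derivative)
    fix t assume t: "T \<le> t" and close: "s $ i - e \<le> x t $ i"
    have xt: "x t' \<le> s + vec e" if "t' \<in> {t - r..t}" for t'
      using T0 that t by (auto simp: T_def)
    \<comment> \<open>Bounding \<open>f (x t) $ i\<close> by quasimonotonicity leaves coordinate \<open>i\<close> untouched.\<close>
    define w where "w = (\<chi> j. if j = i then x t $ i else s $ j + e)"
    have "x t $ j \<le> s $ j + e" for j using xt[of t] r_nonneg by (simp add: less_eq_vec_def)
    then have w: "x t \<le> w" "x t $ i = w $ i" "\<forall>j. \<bar>w $ j - s $ j\<bar> \<le> e"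
      using close e(1) by (auto simp: w_def less_eq_vec_def abs_le_iff) (smt (verit))
    have "t0 \<le> t" using t by (simp add: T_def)
    note delayed_rhs_upper[OF sol t0 this xt w(1,2)]
    also have "f w $ i + g 0 (hist_const (s + vec e)) $ i
        \<le> (f s $ i + K1 * e) + (g 0 (hist_const s) $ i + K2 * e)"
      using 1(3)[OF e(2) w(3), of i] 2(3)[OF e(3), of "s + vec e" i] e(1)
      by (intro add_mono) (auto simp: abs_le_iff)
    also have "\<dots> \<le> - \<eta>" using small by (simp add: \<eta>_def undelayed_field_def field_simps)
    finally show "(f (x t) + g t (hist_at x t)) $ i \<le> - \<eta>" by simp
  qed
  with least[OF e(1)] show False by blast
qed

section \<open>Initial histories\<close>

lemma norm_le_hist_norm:
  assumes "\<phi> \<in> hist_space r" "\<theta> \<in> {-r..0}"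
  shows "norm (\<phi> \<theta>) \<le> hist_norm r \<phi>"
proof -
  have "compact ((\<lambda>\<theta>. norm (\<phi> \<theta>)) ` {-r..0})"
    using assms(1) by (intro compact_continuous_image continuous_intros) (auto simp: hist_space_def)
  then have "bdd_above ((\<lambda>\<theta>. norm (\<phi> \<theta>)) ` {-r..0})"
    by (intro bounded_imp_bdd_above compact_imp_bounded)
  then show ?thesis unfolding hist_norm_def by (rule cSUP_upper[OF assms(2)])
qed

lemma initial_value_nonneg:
  assumes "hist_at x t0 \<in> hist_nonneg r" "s \<in> {t0 - r..t0}"
  shows "0 \<le> x s"
  using assms by (auto simp: hist_nonneg_def hist_at_def dest!: bspec[of _ _ "s - t0"])

lemma initial_component_le_hist_norm:
  assumes "delayed_solution r f g t0 x" "s \<in> {t0 - r..t0}"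
  shows "x s $ i \<le> hist_norm r (hist_at x t0)"
proof -
  have "x s $ i \<le> norm (x s)" using component_le_norm_cart[of "x s" i] by simp
  also have "\<dots> \<le> hist_norm r (hist_at x t0)"
    using norm_le_hist_norm[OF hist_at_in_hist_space[OF assms(1) order_refl], of "s - t0"] assms(2)
    by (simp add: hist_at_def)
  finally show ?thesis .
qed

section \<open>Sub- and supersolutions obtained from the decaying solution\<close>

context
  fixes y :: "real \<Rightarrow> real ^ 'n"
  assumes y_sol: "undelayed_solution f g UNIV y"
    and y_past: "\<And>i. filterlim (\<lambda>t. y t $ i) at_top at_bot"
    and y_future: "\<And>i. ((\<lambda>t. y t $ i) \<longlongrightarrow> 0) at_top"
begin

lemma y_component_derivative:
  "((\<lambda>t. y t $ i) has_real_derivative undelayed_field f g (y t) $ i) (at t)"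
  using has_vector_derivative_component[OF undelayed_solution_derivative[OF y_sol]]
  by (simp add: has_real_derivative_iff_has_vector_derivative)

lemma y_large_in_past: "\<exists>t. \<forall>s\<le>t. v \<le> y s"
proof -
  have "\<forall>\<^sub>F t in at_bot. \<forall>i. v $ i \<le> y t $ i"
    using y_past by (intro eventually_all_finite) (auto simp: filterlim_at_top)
  then show ?thesis by (auto simp: eventually_at_bot_linorder less_eq_vec_def)
qed

text \<open>
  \<open>y\<close> dominates every given vector sufficiently far in the past, and then a subsolution stays below it.
\<close>

lemma subsolution_below_y:
  assumes "0 \<le> undelayed_field f g v"
  shows "v \<le> y t"
proof -
  obtain t1 where "\<forall>s\<le>t1. v \<le> y s" using y_large_in_past by blast
  then have "v \<le> y (min t1 t)" by simp
  then show ?thesis by (rule undelayed_solution_ge_subsolution[OF y_sol _ assms]) simp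
qed

lemma subsolution_nonpos:
  assumes "0 \<le> undelayed_field f g v"
  shows "v \<le> 0"
proof -
  have "v $ i \<le> 0" for i
    using subsolution_below_y[OF assms]
    by (intro tendsto_lowerbound[OF y_future[of i]]) (auto simp: less_eq_vec_def)
  then show ?thesis by (simp add: less_eq_vec_def)
qed

lemma y_nonneg: "0 \<le> y t"
  by (rule subsolution_below_y) (simp add: undelayed_field_0)

text \<open>
  By quasimonotonicity the derivative of \<open>y t $ i\<close> is at least the field at the vector with the same
  \<open>i\<close>-th coordinate and zeros elsewhere, which is at least \<open>- K * y t $ i\<close> near the equilibrium. Strict
  positivity matters because a supersolution with a zero entry would not dominate a neighbourhood of \<open>0\<close>
  in the cone.
\<close>

lemma y_positive: "0 < y t $ i"
proof -
  obtain e0 K where e0: "0 < e0"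
    and K: "\<And>w e i. e \<le> e0 \<Longrightarrow> \<forall>j. \<bar>w $ j - (0::real^'n) $ j\<bar> \<le> e \<Longrightarrow>
      \<bar>undelayed_field f g w $ i - undelayed_field f g 0 $ i\<bar> \<le> K * e"
    using undelayed_field_componentwise_bound[of 0] by blast
  obtain t1 where "\<forall>s\<le>t1. vec 1 \<le> y s" using y_large_in_past by blast
  then have "vec 1 \<le> y (min t1 t)" by simp
  then have "1 \<le> y (min t1 t) $ i" by (simp add: less_eq_vec_def)
  then have init: "0 < y (min t1 t) $ i" by linarith
  show ?thesis
  proof (rule positive_of_linear_decay[where L = K, OF y_component_derivative _ _ e0 init])
    show "0 \<le> y s $ i" for s using y_nonneg[of s] by (simp add: less_eq_vec_def)
    show "min t1 t \<le> t" by simp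
    fix s assume s: "0 \<le> y s $ i" "y s $ i \<le> e0"
    define w where "w = (\<chi> j. if j = i then y s $ i else 0)"
    have near: "\<forall>j. \<bar>w $ j - (0::real^'n) $ j\<bar> \<le> y s $ i" using s by (simp add: w_def)
    have "- K * y s $ i \<le> undelayed_field f g w $ i"
      using K[of "y s $ i" w i] s(2) near by (simp add: undelayed_field_0 abs_le_iff)
    also have "\<dots> \<le> undelayed_field f g (y s) $ i"
      using y_nonneg[of s] by (intro undelayed_field_quasimonotone) (auto simp: w_def less_eq_vec_def)
    finally show "- K * y s $ i \<le> undelayed_field f g (y s) $ i" .
  qed
qed

lemma y_component_running_minimum:
  "\<exists>s\<le>t. \<forall>s'\<le>t. y s $ i \<le> y s' $ i"
proof -
  have "\<forall>\<^sub>F s in at_bot. y t $ i \<le> y s $ i" using y_past by (auto simp: filterlim_at_top)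
  then obtain N where N: "\<And>s. s \<le> N \<Longrightarrow> y t $ i \<le> y s $ i"
    by (auto simp: eventually_at_bot_linorder)
  have "continuous_on {min N t..t} (\<lambda>s. y s $ i)"
    by (intro continuous_at_imp_continuous_on ballI DERIV_isCont[OF y_component_derivative])
  then obtain s where "s \<in> {min N t..t}" "\<forall>s'\<in>{min N t..t}. y s $ i \<le> y s' $ i"
    using continuous_attains_inf[of "{min N t..t}" "\<lambda>s. y s $ i"] by auto
  then show ?thesis
    using N by (intro exI[of _ s]) (auto, smt (verit) atLeastAtMost_iff min_def)
qed

text \<open>
  The supersolution is the vector of running minima of the coordinates of \<open>y\<close> up to time \<open>t\<close>. Each
  coordinate may attain its minimum at a different time; the vector lies below \<open>y\<close> at all these times, and
  agrees with \<open>y\<close> in coordinate \<open>i\<close> at the \<open>i\<close>-th of them, which is what quasimonotonicity asks for.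
  That every entry is a value of \<open>y\<close> at some earlier time shows the vector to be positive, and large when
  \<open>t\<close> is very negative.
\<close>

lemma supersolution_below_y:
  "\<exists>v. undelayed_field f g v \<le> 0 \<and> (\<forall>i. \<exists>s\<le>t. v $ i = y s $ i) \<and> v \<le> y t"
proof -
  obtain \<sigma> where \<sigma>: "\<And>i. \<sigma> i \<le> t" "\<And>i s'. s' \<le> t \<Longrightarrow> y (\<sigma> i) $ i \<le> y s' $ i"
    using y_component_running_minimum by metis
  define v where "v = (\<chi> i. y (\<sigma> i) $ i)"
  have below: "v \<le> y s" if "s \<le> t" for s using \<sigma> that by (simp add: v_def less_eq_vec_def)
  have "undelayed_field f g v $ i \<le> 0" for i
  proof -
    have "undelayed_field f g v $ i \<le> undelayed_field f g (y (\<sigma> i)) $ i"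
      using below[OF \<sigma>(1)] by (intro undelayed_field_quasimonotone) (auto simp: v_def)
    also have "\<dots> \<le> 0"
    proof (rule ccontr)
      \<comment> \<open>A positive derivative would make \<open>y\<close> smaller shortly before its minimum.\<close>
      assume "\<not> ?thesis"
      then obtain h where h: "0 < h" "\<And>k. 0 < k \<Longrightarrow> k < h \<Longrightarrow> y (\<sigma> i - k) $ i < y (\<sigma> i) $ i"
        using DERIV_pos_inc_left[OF y_component_derivative] by (meson not_le)
      have "y (\<sigma> i - h / 2) $ i < y (\<sigma> i) $ i" using h by simp
      moreover have "\<sigma> i - h / 2 \<le> t" using \<sigma>(1)[of i] h(1) by simp
      ultimately show False using \<sigma>(2)[of "\<sigma> i - h / 2" i] by simp
    qed
    finally show ?thesis .
  qed
  then show ?thesis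
    using \<sigma>(1) below[of t] by (intro exI[of _ v]) (auto simp: less_eq_vec_def v_def)
qed

lemma small_positive_supersolution:
  assumes "0 < \<epsilon>"
  shows "\<exists>v. undelayed_field f g v \<le> 0 \<and> (\<forall>i. 0 < v $ i) \<and> norm v < \<epsilon>"
proof -
  have "(y \<longlongrightarrow> 0) at_top" using y_future by (intro vec_tendstoI) simp
  then have "\<forall>\<^sub>F t in at_top. norm (y t) < \<epsilon>"
    using assms by (auto simp: tendsto_iff)
  then obtain t where t: "norm (y t) < \<epsilon>" by (auto simp: eventually_at_top_linorder)
  obtain v where v: "undelayed_field f g v \<le> 0" "\<And>i. \<exists>s\<le>t. v $ i = y s $ i" "v \<le> y t"
    using supersolution_below_y by blast
  have pos: "0 < v $ i" for i using v(2)[of i] y_positive by auto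
  have "norm v \<le> norm (y t)"
    using v(3) pos y_positive[of t]
    by (intro norm_le_componentwise_cart) (auto simp: less_eq_vec_def less_imp_le)
  with v(1) pos t show ?thesis by auto
qed

lemma large_supersolution: "\<exists>v. undelayed_field f g v \<le> 0 \<and> w \<le> v"
proof -
  obtain t where t: "\<And>s. s \<le> t \<Longrightarrow> w \<le> y s" using y_large_in_past by blast
  obtain v where v: "undelayed_field f g v \<le> 0" "\<And>i. \<exists>s\<le>t. v $ i = y s $ i"
    using supersolution_below_y by blast
  have "w \<le> v" unfolding less_eq_vec_def using v(2) t by (metis less_eq_vec_def)
  with v(1) show ?thesis by blast
qed

section \<open>Stability and attractivity\<close>

text \<open>
  Nonnegative data below a small positive supersolution \<open>v\<close> remain between \<open>0\<close> and \<open>v\<close>. The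
  admissible size of the data is the least entry of \<open>v\<close>, which does not depend on \<open>t0\<close>.
\<close>

lemma delayed_origin_stable: "origin_stable r f g"
  unfolding origin_stable_def
proof (intro allI impI)
  fix t0 \<epsilon> :: real assume t0: "0 \<le> t0" and \<epsilon>: "0 < \<epsilon>"
  obtain v where v: "undelayed_field f g v \<le> 0" "\<And>i. 0 < v $ i" "norm v < \<epsilon>"
    using small_positive_supersolution[OF \<epsilon>] by blast
  define \<delta> where "\<delta> = Min (range (\<lambda>i. v $ i))"
  have \<delta>: "0 < \<delta>" "\<And>i. \<delta> \<le> v $ i" using v(2) by (auto simp: \<delta>_def)
  show "\<exists>\<delta>>0. \<forall>x. delayed_solution r f g t0 x \<and> hist_at x t0 \<in> hist_nonneg r \<and>
      hist_norm r (hist_at x t0) < \<delta> \<longrightarrow> (\<forall>t\<ge>t0. hist_norm r (hist_at x t) < \<epsilon>)"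
  proof (intro exI[of _ \<delta>] conjI allI impI \<delta>(1))
    fix x t
    assume "delayed_solution r f g t0 x \<and> hist_at x t0 \<in> hist_nonneg r \<and>
      hist_norm r (hist_at x t0) < \<delta>" and t: "t0 \<le> t"
    then have sol: "delayed_solution r f g t0 x" and nonneg: "hist_at x t0 \<in> hist_nonneg r"
      and small: "hist_norm r (hist_at x t0) < \<delta>" by auto
    note hist0 = initial_value_nonneg[OF nonneg]
    have histv: "x s \<le> v" if "s \<in> {t0 - r..t0}" for s
      unfolding less_eq_vec_def
    proof
      fix i show "x s $ i \<le> v $ i"
        using initial_component_le_hist_norm[OF sol that, of i] small \<delta>(2)[of i] by linarith
    qed
    have "norm (x s) \<le> norm v" if "t0 - r \<le> s" for s
    proof -
      have "0 \<le> x s" by (rule delayed_solution_nonneg[OF sol t0 hist0 that])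
      moreover have "x s \<le> v"
        using delayed_solution_le_supersolution[OF sol t0 histv v(1), of s] histv[of s] that
        by (cases "t0 \<le> s") auto
      ultimately show ?thesis
        by (intro norm_le_componentwise_cart) (auto simp: less_eq_vec_def intro: order_trans abs_ge_self)
    qed
    then have "hist_norm r (hist_at x t) \<le> norm v"
      unfolding hist_norm_def hist_at_def using t r_nonneg by (intro cSUP_least) auto
    with v(3) show "hist_norm r (hist_at x t) < \<epsilon>" by simp
  qed
qed

text \<open>
  A large supersolution bounds the solution, so its upper limit \<open>s\<close> is finite; as a subsolution, \<open>s\<close>
  is nonpositive.
\<close>

lemma delayed_solution_tends_to_0:
  assumes sol: "delayed_solution r f g t0 x" and t0: "0 \<le> t0"
    and init: "hist_at x t0 \<in> hist_nonneg r"
  shows "(x \<longlongrightarrow> 0) at_top"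
proof -
  note hist0 = initial_value_nonneg[OF init]
  obtain v where v: "undelayed_field f g v \<le> 0" "vec (hist_norm r (hist_at x t0)) \<le> v"
    using large_supersolution by blast
  have histv: "x s \<le> v" if "s \<in> {t0 - r..t0}" for s
    unfolding less_eq_vec_def
  proof
    fix i
    have "hist_norm r (hist_at x t0) \<le> v $ i" using v(2) by (simp add: less_eq_vec_def)
    with initial_component_le_hist_norm[OF sol that, of i] show "x s $ i \<le> v $ i" by linarith
  qed
  have nonneg: "0 \<le> x t $ i" if "t0 \<le> t" for t i
    using delayed_solution_nonneg[OF sol t0 hist0, of t] that r_nonneg by (simp add: less_eq_vec_def)
  have bound: "x t $ i \<le> v $ i" if "t0 \<le> t" for t i
    using delayed_solution_le_supersolution[OF sol t0 histv v(1) that] by (simp add: less_eq_vec_def)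
  define B where "B i = {b. \<forall>\<^sub>F t in at_top. x t $ i \<le> b}" for i
  define s where "s = (\<chi> i. Inf (B i))"
  have B_ne: "v $ i \<in> B i" for i
    using bound by (auto simp: B_def eventually_at_top_linorder)
  have B_nonneg: "0 \<le> b" if "b \<in> B i" for b i
  proof -
    have "\<forall>\<^sub>F t in at_top. x t $ i \<le> b \<and> t0 \<le> t"
      using that by (auto simp: B_def intro: eventually_conj eventually_ge_at_top)
    then obtain t where "x t $ i \<le> b" "t0 \<le> t" using eventually_happens' by force
    with nonneg[of t i] show ?thesis by simp
  qed
  have bdd: "bdd_below (B i)" for i using B_nonneg by (rule bdd_belowI)
  have upper: "\<forall>\<^sub>F t in at_top. x t $ i \<le> s $ i + e" if "0 < e" for i e
  proof -
    have "Inf (B i) < s $ i + e" using that by (simp add: s_def)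
    then obtain b where "b \<in> B i" "b < s $ i + e"
      using B_ne[of i] cInf_lessD[of "B i"] by blast
    then show ?thesis by (auto simp: B_def elim: eventually_mono)
  qed
  have least: "\<not> (\<forall>\<^sub>F t in at_top. x t $ i \<le> s $ i - e)" if "0 < e" for i e
  proof
    assume "\<forall>\<^sub>F t in at_top. x t $ i \<le> s $ i - e"
    then have "Inf (B i) \<le> s $ i - e" using bdd by (intro cInf_lower) (auto simp: B_def)
    with that show False by (simp add: s_def)
  qed
  have "s \<le> 0"
    by (rule subsolution_nonpos[OF upper_limit_is_subsolution[OF sol t0 upper least]])
  show ?thesis
  proof (rule vec_tendstoI)
    fix i
    show "((\<lambda>t. x t $ i) \<longlongrightarrow> 0 $ i) at_top"
    proof (rule tendstoI)
      fix e :: real assume e: "0 < e"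
      have "\<forall>\<^sub>F t in at_top. x t $ i \<le> s $ i + e / 2 \<and> t0 \<le> t"
        using upper[of "e / 2" i] e by (auto intro: eventually_conj eventually_ge_at_top)
      then show "\<forall>\<^sub>F t in at_top. dist (x t $ i) (0 $ i) < e"
      proof eventually_elim
        case (elim t)
        then show ?case using nonneg[of t i] \<open>s \<le> 0\<close> e
          by (auto simp: less_eq_vec_def) (smt (verit) field_sum_of_halves)
      qed
    qed
  qed
qed

end

end

theorem theorem1:
  fixes r :: real
    and f :: "real ^ 'n \<Rightarrow> real ^ 'n"
    and g :: "real \<Rightarrow> (real \<Rightarrow> real ^ 'n) \<Rightarrow> real ^ 'n"
    and y :: "real \<Rightarrow> real ^ 'n"
  assumes "monotone_delay_system r f g"
    and "undelayed_solution f g UNIV y"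
    and "\<And>i. filterlim (\<lambda>t. y t $ i) at_top at_bot"
    and "\<And>i. ((\<lambda>t. y t $ i) \<longlongrightarrow> 0) at_top"
  shows "origin_globally_asymptotically_stable r f g"
  unfolding origin_globally_asymptotically_stable_def
  using monotone_delay_system.delayed_origin_stable[OF assms]
    monotone_delay_system.delayed_solution_tends_to_0[OF assms]
  by blast

end
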